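(* The maximum angle condition for tetrahedrons is equivalent to the boundedness of $R_T/h_T$, in the following sense. (i) For every $\gamma_{\max}\in[\pi/3,\pi)$ there exists a constant $D=D(\gamma_{\max})>0$, depending only on $\gamma_{\max}$, such that every tetrahedron $T\subset\mathbb{R}^3$ that satisfies the maximum angle condition with $\gamma_{\max}$ satisfies $$\frac{R_T}{h_T}\le D.$$ (ii) For every constant $D>0$ there exists $\gamma_{\max}=\gamma_{\max}(D)\in[\pi/3,\pi)$, depending only on $D$, such that every tetrahedron $T\subset\mathbb{R}^3$ with $R_T/h_T\le D$ satisfies the maximum angle condition with $\gamma_{\max}$.
   Context: A tetrahedron is a non-degenerate one in $\mathbb{R}^3$; $h_T:=\operatorname{diam}T$ and $|T|$ denotes its volume. Let $h_1\le h_2\le\cdots\le h_6=h_T$ be the lengths of the six edges of $T$ in nondecreasing order. Define $$R_T:=\frac{h_1h_2h_T}{|T|}\,h_T.$$ For $\gamma_{\max}\in[\pi/3,\pi)$, $T$ satisfies the maximum angle condition with $\gamma_{\max}$ if all internal angles of the four triangular faces of $T$ and all six (internal) dihedral angles between faces of $T$ are less than or equal to $\gamma_{\max}$. *)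

theory Defs
  imports "HOL-Analysis.Analysis" "HOL-Library.Multiset"
begin

(* Non-degeneracy is part of "simplex": the four vertices are affinely independent. *)
definition tetrahedron :: "(real ^ 3) set \<Rightarrow> bool" where
  "tetrahedron T \<longleftrightarrow> 3 simplex T"

definition vertices :: "(real ^ 3) set \<Rightarrow> (real ^ 3) set" where
  "vertices S = {x. x extreme_point_of S}"

(* A multiset is sorted, so edges of equal length are counted with multiplicity. *)
definition edge_lengths :: "(real ^ 3) set \<Rightarrow> real list" where
  "edge_lengths T = sorted_list_of_multiset (image_mset diameter (mset_set {e. e edge_of T}))"

(* h_1 and h_2 are the list entries with indices 0 and 1. *)
definition R_param :: "(real ^ 3) set \<Rightarrow> real" where
  "R_param T =
     (edge_lengths T ! 0 * edge_lengths T ! 1 * diameter T) / measure lebesgue T * diameter T"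

(* Only used for nonzero u and v. *)
definition vec_angle :: "real ^ 3 \<Rightarrow> real ^ 3 \<Rightarrow> real" where
  "vec_angle u v = arccos ((u \<bullet> v) / (norm u * norm v))"

definition orth_part :: "real ^ 3 \<Rightarrow> real ^ 3 \<Rightarrow> real ^ 3" where
  "orth_part w u = u - ((u \<bullet> w) / (w \<bullet> w)) *\<^sub>R w"

(* Internal dihedral angle, along the common edge ab, between the triangles abc and abd:
   the angle between the rays in which a plane orthogonal to the edge meets the half-planes
   that are bounded by the line ab and contain c and d, respectively. *)
definition dihedral_angle :: "real ^ 3 \<Rightarrow> real ^ 3 \<Rightarrow> real ^ 3 \<Rightarrow> real ^ 3 \<Rightarrow> real" where
  "dihedral_angle a b c d = vec_angle (orth_part (b - a) (c - a)) (orth_part (b - a) (d - a))"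

(* First conjunct: the angle at a of the triangular face F. *)
definition max_angle_condition :: "real \<Rightarrow> (real ^ 3) set \<Rightarrow> bool" where
  "max_angle_condition \<gamma> T \<longleftrightarrow>
     (\<forall>F a b c. F facet_of T \<and> vertices F = {a, b, c} \<and> distinct [a, b, c]
        \<longrightarrow> vec_angle (b - a) (c - a) \<le> \<gamma>) \<and>
     (\<forall>F G a b c d. F facet_of T \<and> G facet_of T \<and>
        vertices F = {a, b, c} \<and> vertices G = {a, b, d} \<and> distinct [a, b, c, d]
        \<longrightarrow> dihedral_angle a b c d \<le> \<gamma>)"

end

theory Submission
  imports Defs
begin

text \<open>
  Let \<open>ab\<close> be an edge of a tetrahedron \<open>abcd\<close> with dihedral angle \<open>\<phi>\<close> and let \<open>C\<close>, \<open>E\<close> be the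
  distances of \<open>c\<close>, \<open>d\<close> from the line \<open>ab\<close>. Six times the volume is \<open>|ab| C E sin \<phi>\<close>.

  For (i), some dihedral angle is at least \<open>pi / 3\<close>. In a triangle with angles at most \<open>\<gamma>\<close>, at most
  one angle is below \<open>(pi - \<gamma>) / 2\<close>, so \<open>C\<close> and \<open>E\<close> are comparable to edges \<open>pc\<close>, \<open>qd\<close> with
  \<open>p, q \<in> {a, b}\<close>. The edges \<open>ab\<close>, \<open>pc\<close>, \<open>qd\<close> form a spanning tree, so the diameter is at most
  the sum of their lengths, while the product of any two of them is at least \<open>h\<^sub>1 h\<^sub>2\<close>.

  For (ii), if a face angle or dihedral angle \<open>\<theta>\<close> is obtuse, then six times the volume is at most
  \<open>2 h\<^sub>1 h\<^sub>2 h\<^sub>T sin \<theta>\<close>, whichever two edges are the shortest. Hence a bound on the ratio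
  keeps \<open>sin \<theta>\<close> away from zero.
\<close>

section \<open>Faces, edges and volume of a tetrahedron\<close>

lemma vertices_convex_hull:
  assumes "\<not> affine_dependent S"
  shows "vertices (convex hull S) = S"
  using assms by (simp add: vertices_def extreme_point_of_convex_hull_affine_independent)

lemma facet_vertices_simplex:
  assumes S: "\<not> affine_dependent S" "card S = 4"
    and abc: "{a, b, c} \<subseteq> S" "distinct [a, b, c]"
  shows "convex hull {a, b, c} facet_of convex hull S" "vertices (convex hull {a, b, c}) = {a, b, c}"
proof -
  have "card (S - {a, b, c}) = 1"
    using abc S card_Diff_subset[of "{a, b, c}" S] by simp
  then obtain d where "S - {a, b, c} = {d}" by (rule card_1_singletonE)
  then have "d \<in> S" "{a, b, c} = S - {d}" using abc by auto
  then show "convex hull {a, b, c} facet_of convex hull S"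
    using S by (auto simp: facet_of_convex_hull_affine_independent_alt)
  show "vertices (convex hull {a, b, c}) = {a, b, c}"
    using S abc affine_dependent_subset vertices_convex_hull by blast
qed

lemma facet_vertices_subset:
  assumes "\<not> affine_dependent S" "F facet_of convex hull S"
  shows "vertices F \<subseteq> S"
proof -
  obtain u where "u \<in> S" "F = convex hull (S - {u})"
    using assms by (auto simp: facet_of_convex_hull_affine_independent)
  then show ?thesis
    using assms affine_dependent_subset[of "S - {u}" S] vertices_convex_hull[of "S - {u}"] by auto
qed

text \<open>The facets are the hulls of three of the four vertices, so quantification over facets
  turns into quantification over labelled vertices, the form in which the volume formula
  applies.\<close>

lemma max_angle_condition_convex_hull:
  assumes "\<not> affine_dependent S" "card S = 4"
  shows "max_angle_condition \<gamma> (convex hull S) \<longleftrightarrow>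
     (\<forall>a b c. {a, b, c} \<subseteq> S \<and> distinct [a, b, c] \<longrightarrow> vec_angle (b - a) (c - a) \<le> \<gamma>) \<and>
     (\<forall>a b c d. {a, b, c, d} \<subseteq> S \<and> distinct [a, b, c, d] \<longrightarrow> dihedral_angle a b c d \<le> \<gamma>)"
    (is "?L \<longleftrightarrow> ?R")
proof
  assume L: ?L
  show ?R
  proof (intro conjI allI impI)
    fix a b c assume "{a, b, c} \<subseteq> S \<and> distinct [a, b, c]"
    then show "vec_angle (b - a) (c - a) \<le> \<gamma>"
      using L[unfolded max_angle_condition_def, THEN conjunct1, rule_format, of "convex hull {a, b, c}" a b c]
        facet_vertices_simplex[OF assms, of a b c] by simp
  next
    fix a b c d assume *: "{a, b, c, d} \<subseteq> S \<and> distinct [a, b, c, d]"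
    then show "dihedral_angle a b c d \<le> \<gamma>"
      using L[unfolded max_angle_condition_def, THEN conjunct2, rule_format,
          of "convex hull {a, b, c}" "convex hull {a, b, d}" a b c d]
        facet_vertices_simplex[OF assms, of a b c] facet_vertices_simplex[OF assms, of a b d]
      by simp
  qed
next
  assume R: ?R
  show ?L
    unfolding max_angle_condition_def
  proof (intro conjI allI impI)
    fix F a b c assume "F facet_of convex hull S \<and> vertices F = {a, b, c} \<and> distinct [a, b, c]"
    then show "vec_angle (b - a) (c - a) \<le> \<gamma>"
      using R facet_vertices_subset[OF assms(1), of F] by metis
  next
    fix F G a b c d
    assume *: "F facet_of convex hull S \<and> G facet_of convex hull S \<and>
        vertices F = {a, b, c} \<and> vertices G = {a, b, d} \<and> distinct [a, b, c, d]"
    then have "{a, b, c, d} \<subseteq> S"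
      using facet_vertices_subset[OF assms(1), of F] facet_vertices_subset[OF assms(1), of G] by auto
    then show "dihedral_angle a b c d \<le> \<gamma>" using R * by blast
  qed
qed

section \<open>Edges and the product of the two smallest lengths\<close>

text \<open>Sorting the elements themselves rather than their values keeps apart different edges of
  equal length: different positions in the list belong to different edges.\<close>

lemma sorted_list_of_image_mset:
  fixes f :: "'a \<Rightarrow> 'b::linorder"
  assumes "finite E"
  obtains xs where "distinct xs" "set xs = E" "sorted (map f xs)"
    "sorted_list_of_multiset (image_mset f (mset_set E)) = map f xs"
proof -
  obtain ys where ys: "set ys = E" "distinct ys"
    using assms finite_distinct_list by blast
  let ?xs = "sort_key f ys"
  have "image_mset f (mset_set E) = mset (map f ys)"
    using ys by (auto simp: mset_set_set)
  then have "sorted_list_of_multiset (image_mset f (mset_set E)) = sort (map f ys)"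
    by (simp only: sorted_list_of_multiset_mset)
  also have "\<dots> = map f ?xs"
    by (rule properties_for_sort) simp_all
  finally show thesis using ys by (intro that[of ?xs]) simp_all
qed

lemma sorted_nth_01:
  fixes f :: "'a \<Rightarrow> real"
  assumes "finite E" "2 \<le> card E" and nn: "\<forall>e\<in>E. 0 \<le> f e"
  defines "hs \<equiv> sorted_list_of_multiset (image_mset f (mset_set E))"
  shows "\<exists>e\<in>E. \<exists>e'\<in>E. e \<noteq> e' \<and> hs ! 0 = f e \<and> hs ! 1 = f e'"
    and "\<lbrakk>e \<in> E; e' \<in> E; e \<noteq> e'\<rbrakk> \<Longrightarrow> hs ! 0 * hs ! 1 \<le> f e * f e'"
proof -
  obtain xs where xs: "distinct xs" "set xs = E" "sorted (map f xs)" "hs = map f xs"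
    using sorted_list_of_image_mset[OF \<open>finite E\<close>] unfolding hs_def by metis
  have len: "length xs \<ge> 2" using xs assms(2) distinct_card by fastforce
  then obtain x y zs where xyz: "xs = x # y # zs"
    by (cases xs; cases "tl xs") auto
  show "\<exists>e\<in>E. \<exists>e'\<in>E. e \<noteq> e' \<and> hs ! 0 = f e \<and> hs ! 1 = f e'"
    using xs xyz by auto
  show "hs ! 0 * hs ! 1 \<le> f e * f e'" if e: "e \<in> E" "e' \<in> E" "e \<noteq> e'"
  proof -
    have *: "f x \<le> f z" "z = x \<or> f y \<le> f z" if "z \<in> E" for z
      using that xs xyz by auto
    have E: "x \<in> E" "y \<in> E" using xs xyz by auto
    \<comment> \<open>At most one of \<open>e\<close>, \<open>e'\<close> is the first element
      \<open>x\<close>; the other one has a value of at least \<open>f y\<close>.\<close>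
    have "f x * f y \<le> f e * f e'"
    proof (cases "e' = x")
      case True
      then have "f y * f x \<le> f e * f e'"
        using * e E nn by (intro mult_mono) auto
      then show ?thesis by (simp add: mult.commute)
    next
      case False
      then show ?thesis using * e E nn by (intro mult_mono) auto
    qed
    then show ?thesis using xs xyz by simp
  qed
qed

lemma edge_of_simplex_iff:
  assumes "\<not> affine_dependent S"
  shows "e edge_of convex hull S \<longleftrightarrow> (\<exists>x\<in>S. \<exists>y\<in>S. x \<noteq> y \<and> e = closed_segment x y)"
proof
  assume "e edge_of convex hull S"
  then obtain C where C: "C \<subseteq> S" "e = convex hull C" "aff_dim C = 1"
    using assms by (auto simp: edge_of_def face_of_convex_hull_affine_independent aff_dim_convex_hull)
  then have "card C = 2"
    using aff_dim_affine_independent[of C] affine_dependent_subset[of C S] assms by auto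
  then show "\<exists>x\<in>S. \<exists>y\<in>S. x \<noteq> y \<and> e = closed_segment x y"
    using C by (auto simp: card_2_iff segment_convex_hull)
next
  assume "\<exists>x\<in>S. \<exists>y\<in>S. x \<noteq> y \<and> e = closed_segment x y"
  then obtain x y where "{x, y} \<subseteq> S" "x \<noteq> y" "e = convex hull {x, y}"
    by (auto simp: segment_convex_hull)
  then show "e edge_of convex hull S"
    using assms unfolding edge_of_def face_of_convex_hull_affine_independent[OF assms]
    by (intro conjI exI[of _ "{x, y}"]) (auto simp: aff_dim_convex_hull)
qed

lemma diameter_convex_hull_attained:
  fixes S :: "'a::euclidean_space set"
  assumes "finite S" "S \<noteq> {}"
  shows "\<exists>x\<in>S. \<exists>y\<in>S. diameter (convex hull S) = dist x y"
proof -
  obtain u v where uv: "u \<in> S" "v \<in> S"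
    "\<And>x y. x \<in> convex hull S \<Longrightarrow> y \<in> convex hull S \<Longrightarrow> norm (x - y) \<le> norm (u - v)"
    using simplex_extremal_le[OF assms] by blast
  have "diameter (convex hull S) \<le> dist u v"
    using uv by (intro diameter_le) (auto simp: dist_norm)
  moreover have "dist u v \<le> diameter (convex hull S)"
    using uv assms by (intro diameter_bounded_bound) (auto simp: hull_inc intro: finite_imp_bounded_convex_hull)
  ultimately show ?thesis using uv by (metis antisym)
qed

lemma dist_le_diameter_convex_hull:
  fixes S :: "'a::euclidean_space set"
  assumes "finite S" "x \<in> S" "y \<in> S"
  shows "dist x y \<le> diameter (convex hull S)"
  using assms by (intro diameter_bounded_bound) (auto simp: hull_inc intro: finite_imp_bounded_convex_hull)

lemma diameter_closed_segment: "diameter (closed_segment x y) = dist x (y::'a::euclidean_space)"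
proof -
  obtain u v where "u \<in> {x, y}" "v \<in> {x, y}" "diameter (convex hull {x, y}) = dist u v"
    using diameter_convex_hull_attained[of "{x, y}"] by blast
  moreover have "dist x y \<le> diameter (convex hull {x, y})"
    by (rule dist_le_diameter_convex_hull) auto
  ultimately show ?thesis
    by (auto simp: segment_convex_hull dist_commute)
qed

text \<open>The first fact lets the upper volume bounds run through all choices of the two shortest
  edges. The second compares their product with that of any two chosen edges, for the lower volume
  bound.\<close>

lemma edge_lengths_nth_01:
  assumes S: "\<not> affine_dependent S" "card S = 4"
  defines "hs \<equiv> edge_lengths (convex hull S)"
  shows "\<exists>x\<in>S. \<exists>y\<in>S. \<exists>x'\<in>S. \<exists>y'\<in>S. x \<noteq> y \<and> x' \<noteq> y' \<and> {x, y} \<noteq> {x', y'} \<and>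
           hs ! 0 = dist x y \<and> hs ! 1 = dist x' y'"
    and "\<lbrakk>{x, y, x', y'} \<subseteq> S; x \<noteq> y; x' \<noteq> y'; {x, y} \<noteq> {x', y'}\<rbrakk>
           \<Longrightarrow> hs ! 0 * hs ! 1 \<le> dist x y * dist x' y'"
proof -
  let ?E = "{e. e edge_of convex hull S}"
  note edge = edge_of_simplex_iff[OF S(1)]
  have "?E \<subseteq> case_prod closed_segment ` (S \<times> S)"
    unfolding edge by force
  moreover have "finite S"
    using aff_independent_finite[OF S(1)] .
  ultimately have fin: "finite ?E"
    by (meson finite_SigmaI finite_imageI finite_subset)
  \<comment> \<open>Two different edges at one vertex ensure that the list has entries with indices
    0 and 1.\<close>
  obtain T where "T \<subseteq> S" "card T = 3"
    using obtain_subset_with_card_n[of 3 S] S by auto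
  then obtain a b c where abc: "{a, b, c} \<subseteq> S" "a \<noteq> b" "a \<noteq> c" "b \<noteq> c"
    by (auto simp: card_3_iff)
  then have "{closed_segment a b, closed_segment a c} \<subseteq> ?E"
    unfolding edge by blast
  then have "card {closed_segment a b, closed_segment a c} \<le> card ?E"
    using fin by (intro card_mono)
  then have card: "2 \<le> card ?E" using abc by (simp add: doubleton_eq_iff)
  have hs: "hs = sorted_list_of_multiset (image_mset diameter (mset_set ?E))"
    by (simp add: hs_def edge_lengths_def)
  have nn: "\<forall>e\<in>?E. 0 \<le> diameter e"
    unfolding edge by (auto simp: diameter_closed_segment)
  obtain e e' where e: "e \<in> ?E" "e' \<in> ?E" "e \<noteq> e'" "hs ! 0 = diameter e" "hs ! 1 = diameter e'"
    using sorted_nth_01(1)[where f = diameter, OF fin card nn, folded hs] by (elim bexE conjE)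
  then obtain x y x' y' where xy: "x \<in> S" "y \<in> S" "x' \<in> S" "y' \<in> S" "x \<noteq> y" "x' \<noteq> y'"
     "e = closed_segment x y" "e' = closed_segment x' y'"
    unfolding mem_Collect_eq edge by blast
  moreover have "{x, y} \<noteq> {x', y'}"
    using e(3) unfolding xy(7,8) closed_segment_eq .
  moreover have "hs ! 0 = dist x y" "hs ! 1 = dist x' y'"
    using e(4,5) unfolding xy(7,8) diameter_closed_segment .
  ultimately show "\<exists>x\<in>S. \<exists>y\<in>S. \<exists>x'\<in>S. \<exists>y'\<in>S. x \<noteq> y \<and> x' \<noteq> y' \<and> {x, y} \<noteq> {x', y'} \<and>
           hs ! 0 = dist x y \<and> hs ! 1 = dist x' y'"
    by blast
  show "hs ! 0 * hs ! 1 \<le> dist x y * dist x' y'"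
    if xy: "{x, y, x', y'} \<subseteq> S" "x \<noteq> y" "x' \<noteq> y'" "{x, y} \<noteq> {x', y'}" for x y x' y'
  proof -
    have "closed_segment x y \<in> ?E" "closed_segment x' y' \<in> ?E"
      using xy unfolding mem_Collect_eq edge by blast+
    moreover have "closed_segment x y \<noteq> closed_segment x' y'"
      using xy by simp
    ultimately show ?thesis
      using sorted_nth_01(2)[where f = diameter, OF fin card nn, of "closed_segment x y" "closed_segment x' y'", folded hs]
      by (simp add: diameter_closed_segment)
  qed
qed

lemma measure_tetrahedron_pos:
  fixes S :: "(real^3) set"
  assumes "\<not> affine_dependent S" "card S = 4"
  shows "0 < measure lebesgue (convex hull S)"
proof -
  have "interior (convex hull S) \<noteq> {}"
    using assms by (subst interior_convex_hull_eq_empty) auto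
  then have "\<not> negligible (convex hull S)"
    by (simp add: negligible_convex_interior)
  moreover have "convex hull S \<in> lmeasurable"
    using aff_independent_finite[OF assms(1)]
    by (simp add: finite_imp_compact_convex_hull lmeasurable_compact)
  ultimately show ?thesis
    using measure_nonneg[of lebesgue "convex hull S"]
    by (simp add: negligible_iff_measure order_less_le)
qed

unbundle cross3_syntax

section \<open>Angles and cross products\<close>

lemma vec_angle_cos_le_1: "\<bar>(u \<bullet> v) / (norm u * norm v)\<bar> \<le> 1"
  using Cauchy_Schwarz_ineq2[of u v] by (cases "u = 0 \<or> v = 0") (auto simp: divide_simps)

text \<open>Written as a product, the identity covers zero vectors too: both sides then
  vanish.\<close>

lemma cos_vec_angle: "cos (vec_angle u v) * (norm u * norm v) = u \<bullet> v"
  using vec_angle_cos_le_1[of u v]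
  by (cases "u = 0 \<or> v = 0") (auto simp: vec_angle_def cos_arccos_abs)

lemma vec_angle_bounds: "0 \<le> vec_angle u v" "vec_angle u v \<le> pi"
  using vec_angle_cos_le_1[of u v]
  unfolding vec_angle_def abs_le_iff by (simp_all add: arccos_lbound arccos_ubound)

text \<open>The Lagrange identity \<open>norm_cross_dot\<close> plays the part of the Pythagorean
  identity for sine and cosine.\<close>

lemma sin_vec_angle: "sin (vec_angle u v) * (norm u * norm v) = norm (u \<times> v)"
proof (rule power2_eq_imp_eq)
  have "(sin (vec_angle u v) * (norm u * norm v))\<^sup>2 + (cos (vec_angle u v) * (norm u * norm v))\<^sup>2
      = (norm u * norm v)\<^sup>2"
    by (simp add: power_mult_distrib flip: distrib_right)
  then show "(sin (vec_angle u v) * (norm u * norm v))\<^sup>2 = (norm (u \<times> v))\<^sup>2"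
    using norm_cross_dot[of u v] by (simp add: cos_vec_angle)
qed (simp_all add: vec_angle_bounds sin_ge_zero)

text \<open>The map \<open>u \<mapsto> w \<times> u\<close> kills the component along
  \<open>w\<close>, turns the rest by a right angle about \<open>w\<close> and scales it by
  \<open>norm w\<close>. Hence dihedral angles can be measured between cross products.\<close>

lemma inner_orth_part:
  assumes "w \<noteq> 0"
  shows "(w \<bullet> w) * (orth_part w u \<bullet> orth_part w v) = (w \<times> u) \<bullet> (w \<times> v)"
  using assms by (simp add: orth_part_def dot_cross inner_diff inner_commute field_simps)

lemma norm_orth_part:
  assumes "w \<noteq> 0"
  shows "norm w * norm (orth_part w u) = norm (w \<times> u)"
  using inner_orth_part[OF assms, of u u]
  by (simp add: norm_eq_sqrt_inner flip: real_sqrt_mult)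

lemma dihedral_angle_cross:
  assumes "a \<noteq> b"
  shows "dihedral_angle a b c d = vec_angle ((b - a) \<times> (c - a)) ((b - a) \<times> (d - a))"
proof -
  define w where "w = b - a"
  have w: "w \<noteq> 0" using assms by (simp add: w_def)
  have "(w \<times> (c - a)) \<bullet> (w \<times> (d - a)) / (norm (w \<times> (c - a)) * norm (w \<times> (d - a)))
     = (w \<bullet> w) * (orth_part w (c - a) \<bullet> orth_part w (d - a))
        / ((w \<bullet> w) * (norm (orth_part w (c - a)) * norm (orth_part w (d - a))))"
    by (simp add: inner_orth_part[OF w, symmetric] norm_orth_part[OF w, symmetric]
       dot_square_norm power2_eq_square mult_ac)
  also have "\<dots> = (orth_part w (c - a) \<bullet> orth_part w (d - a))
        / (norm (orth_part w (c - a)) * norm (orth_part w (d - a)))"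
    using w by simp
  finally show ?thesis by (simp add: dihedral_angle_def vec_angle_def w_def)
qed

text \<open>The cross product of two face normals is parallel to the common edge \<open>w\<close>,
  with the triple product, up to sign six times the volume, as coefficient.\<close>

lemma sin_dihedral_angle:
  "sin (vec_angle (w \<times> u) (w \<times> v)) * (norm (w \<times> u) * norm (w \<times> v)) = norm w * \<bar>w \<bullet> (u \<times> v)\<bar>"
proof -
  have "(w \<times> u) \<times> (w \<times> v) = (w \<bullet> (u \<times> v)) *\<^sub>R w"
    using dot_cross_self[of w v]
    by (simp add: cross_cross_det  flip: dot_cross_det) (simp add: cross3_simps)
  then show ?thesis by (simp add: sin_vec_angle mult.commute)
qed

text \<open>
  If all three angles at the edges through a vertex were below \<open>pi / 3\<close>, the outer unit normals
  of the three faces would have pairwise inner products below \<open>-1/2\<close>, so their sum would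
  have negative squared norm.
\<close>

lemma exists_dihedral_ge_pi_third:
  fixes u v w :: "real^3"
  assumes "u \<bullet> (v \<times> w) \<noteq> 0"
  shows "vec_angle (u \<times> v) (u \<times> w) \<ge> pi/3 \<or> vec_angle (v \<times> w) (v \<times> u) \<ge> pi/3
     \<or> vec_angle (w \<times> u) (w \<times> v) \<ge> pi/3"
proof (rule ccontr)
  assume neg: "\<not> ?thesis"
  define n where "n x = x /\<^sub>R norm x" for x :: "real^3"
  have 1: "n x \<bullet> n y < -1/2" if "x \<noteq> 0" "y \<noteq> 0" "vec_angle x (-y) < pi/3" for x y
  proof -
    have "cos (vec_angle x (-y)) > cos (pi/3)"
      using that vec_angle_bounds[of x "-y"] by (intro cos_monotone_0_pi) auto
    then have "1/2 * (norm x * norm y) < cos (vec_angle x (-y)) * (norm x * norm y)"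
      using that by (intro mult_strict_right_mono) (auto simp: cos_60)
    then have "x \<bullet> y < -1/2 * (norm x * norm y)"
      using cos_vec_angle[of x "-y"] by simp
    then have "(x \<bullet> y) / (norm x * norm y) < -1/2"
      using that by (subst pos_divide_less_eq) auto
    then show ?thesis by (simp add: n_def field_simps)
  qed
  have triple: "u \<bullet> (v \<times> w) = w \<bullet> (u \<times> v)" "u \<bullet> (v \<times> w) = v \<bullet> (w \<times> u)"
    by (simp_all add: cross3_simps)
  have nz: "u \<times> v \<noteq> 0" "v \<times> w \<noteq> 0" "w \<times> u \<noteq> 0"
    using assms triple by auto
  \<comment> \<open>With the normals in cyclic order, each of the three angles lies between one
    normal and the negative of another, as in fact \<open>1\<close>.\<close>
  have sk: "u \<times> w = - (w \<times> u)" "v \<times> u = - (u \<times> v)" "w \<times> v = - (v \<times> w)"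
    by (rule cross_skew)+
  let ?x = "n (u \<times> v)" and ?y = "n (v \<times> w)" and ?z = "n (w \<times> u)"
  have "?x \<bullet> ?z < -1/2" "?y \<bullet> ?x < -1/2" "?z \<bullet> ?y < -1/2"
    using neg nz unfolding sk de_Morgan_disj not_le by (blast intro: 1)+
  moreover have "?x \<bullet> ?x = 1" "?y \<bullet> ?y = 1" "?z \<bullet> ?z = 1"
    using nz by (simp_all add: n_def dot_square_norm power2_eq_square)
  moreover have "(?x + ?y + ?z) \<bullet> (?x + ?y + ?z) \<ge> 0" by simp
  ultimately show False by (simp add: inner_add inner_commute)
qed

section \<open>Angle sum and sines in a triangle\<close>

text \<open>This is the angle sum in the triangle \<open>0\<close>, \<open>u\<close>,
  \<open>v\<close>. Both sines have the numerator \<open>norm (u \<times> v)\<close>, twice the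
  area, so the addition formula for the cosine reduces to the Lagrange identity.\<close>

lemma cos_third_angle:
  fixes u v :: "real^3"
  assumes "u \<noteq> 0" "v \<noteq> 0" "u \<noteq> v"
  shows "cos (vec_angle (-v) (u - v)) = - cos (vec_angle u v + vec_angle (-u) (v - u))"
proof -
  let ?w = "v - u"
  have pos: "norm u > 0" "norm v > 0" "norm ?w > 0" using assms by auto
  have c: "u \<times> ?w = u \<times> v" by (simp add: Cross3.right_diff_distrib)
  have nn: "norm (u \<times> v) * norm (u \<times> v) = (u \<bullet> u) * (v \<bullet> v) - (u \<bullet> v)\<^sup>2"
    using norm_cross_dot[of u v] by (simp add: power_mult_distrib dot_square_norm flip: power2_eq_square)
  have cu: "cos (vec_angle u v) = (u \<bullet> v) / (norm u * norm v)"
     "cos (vec_angle (-u) ?w) = - (u \<bullet> ?w) / (norm u * norm ?w)"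
     "cos (vec_angle (-v) (u - v)) = (v \<bullet> ?w) / (norm v * norm ?w)"
     using pos cos_vec_angle[of u v] cos_vec_angle[of "-u" ?w] cos_vec_angle[of "-v" "u-v"]
     by (simp_all add: field_simps norm_minus_commute inner_diff)
  have su: "sin (vec_angle u v) = norm (u \<times> v) / (norm u * norm v)"
     "sin (vec_angle (-u) ?w) = norm (u \<times> v) / (norm u * norm ?w)"
     using pos sin_vec_angle[of u v] sin_vec_angle[of "-u" ?w]
     by (simp_all add: field_simps c)
  have "sin (vec_angle u v) * sin (vec_angle (-u) ?w) - cos (vec_angle u v) * cos (vec_angle (-u) ?w)
     = (norm (u \<times> v) * norm (u \<times> v) + (u \<bullet> v) * (u \<bullet> ?w)) / ((u \<bullet> u) * (norm v * norm ?w))"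
    unfolding cu su by (simp add: dot_square_norm power2_eq_square add_divide_distrib mult_ac)
  also have "norm (u \<times> v) * norm (u \<times> v) + (u \<bullet> v) * (u \<bullet> ?w) = (u \<bullet> u) * (v \<bullet> ?w)"
    by (simp add: nn inner_diff inner_commute power2_eq_square algebra_simps)
  also have "(u \<bullet> u) * (v \<bullet> ?w) / ((u \<bullet> u) * (norm v * norm ?w)) = cos (vec_angle (-v) (u - v))"
    using assms by (simp add: cu)
  finally show ?thesis by (simp add: cos_add)
qed

text \<open>Sine increases up to \<open>pi/2\<close> and decreases afterwards, so its minimum over
  the interval sits at an endpoint.\<close>

lemma sin_ge_min_sin:
  fixes x \<gamma> :: real
  assumes "0 \<le> \<gamma>" "\<gamma> < pi" "(pi - \<gamma>) / 2 \<le> x" "x \<le> \<gamma>"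
  shows "min (sin \<gamma>) (sin ((pi - \<gamma>) / 2)) \<le> sin x"
proof (cases "x \<le> pi/2")
  case True
  then have "sin ((pi - \<gamma>) / 2) \<le> sin x" using assms by (intro sin_monotone_2pi_le) auto
  then show ?thesis by simp
next
  case False
  then have "sin (pi - \<gamma>) \<le> sin (pi - x)" using assms by (intro sin_monotone_2pi_le) auto
  then show ?thesis by simp
qed

text \<open>If both angles were below \<open>(pi - \<gamma>) / 2\<close>, their sum would be below
  \<open>pi - \<gamma>\<close>, and the third angle would exceed \<open>\<gamma>\<close>.\<close>

lemma two_angles_sin_bound:
  fixes u v :: "real^3" and \<gamma> :: real
  assumes "u \<noteq> 0" "v \<noteq> 0" "u \<noteq> v" and \<gamma>: "0 \<le> \<gamma>" "\<gamma> < pi"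
    and le: "vec_angle u v \<le> \<gamma>" "vec_angle (-u) (v - u) \<le> \<gamma>" "vec_angle (-v) (u - v) \<le> \<gamma>"
  defines "s \<equiv> min (sin \<gamma>) (sin ((pi - \<gamma>) / 2))"
  shows "sin (vec_angle u v) \<ge> s \<or> sin (vec_angle (-u) (v - u)) \<ge> s"
proof -
  have "vec_angle u v \<ge> (pi - \<gamma>)/2 \<or> vec_angle (-u) (v - u) \<ge> (pi - \<gamma>)/2"
  proof (rule ccontr)
    assume "\<not> ?thesis"
    then have "vec_angle u v + vec_angle (-u) (v - u) < pi - \<gamma>" by (auto simp: field_simps)
    then have "cos (pi - \<gamma>) < cos (vec_angle u v + vec_angle (-u) (v - u))"
      using \<gamma> vec_angle_bounds by (intro cos_monotone_0_pi) (auto simp: add_nonneg_nonneg)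
    then have "cos (vec_angle (-v) (u - v)) < cos \<gamma>"
      using cos_third_angle[OF assms(1-3)] by simp
    moreover have "cos \<gamma> \<le> cos (vec_angle (-v) (u - v))"
      using le \<gamma> vec_angle_bounds by (intro cos_monotone_0_pi_le) auto
    ultimately show False by simp
  qed
  then show ?thesis
    unfolding s_def using sin_ge_min_sin[OF \<gamma>] le by blast
qed

lemma measure_tetrahedron:
  fixes a b c d :: "real^3"
  assumes "distinct [a, b, c, d]"
  shows "measure lebesgue (convex hull {a, b, c, d}) = \<bar>(b - a) \<bullet> ((c - a) \<times> (d - a))\<bar> / 6"
proof -
  \<comment> \<open>\<open>f\<close> numbers the vertices other than \<open>a\<close>; the vectors
    from \<open>a\<close> to them are the columns of the determinant in the simplex volume
    formula.\<close>
  define f where "f j = (if j = 1 then b else if j = 2 then c else d)" for j :: 3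
  have ne: "(1::3) \<noteq> 2" "(1::3) \<noteq> 3" "(2::3) \<noteq> 3" by simp_all
  have bij: "bij_betw f UNIV ({a, b, c, d} - {a})"
    using assms ne unfolding bij_betw_def inj_on_def UNIV_3 by (auto simp: f_def)
  have "measure lebesgue (convex hull {a, b, c, d}) = measure lborel (convex hull {a, b, c, d})"
    by (intro measure_completion) (auto simp: finite_imp_compact_convex_hull compact_imp_closed)
  also have "\<dots> = \<bar>det (\<chi> i j. f j $ i - a $ i)\<bar> / fact CARD(3)"
    using assms by (intro content_simplex bij) auto
  also have "det (\<chi> i j. f j $ i - a $ i) = (b - a) \<bullet> ((c - a) \<times> (d - a))"
    using ne by (simp add: det_3 f_def cross3_simps)
  finally show ?thesis by (simp add: fact_numeral)
qed

section \<open>Volume bounds\<close>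

text \<open>Choose \<open>p\<close> as an end of \<open>ab\<close> where the angle has sine at least
  \<open>s\<close>. Twice the area is this sine times the product of the two sides meeting at
  \<open>p\<close>.\<close>

lemma norm_cross_triangle_ge:
  fixes a b c :: "real^3" and \<gamma> :: real
  assumes "distinct [a, b, c]" and \<gamma>: "0 \<le> \<gamma>" "\<gamma> < pi"
    and le: "vec_angle (b - a) (c - a) \<le> \<gamma>" "vec_angle (a - b) (c - b) \<le> \<gamma>" "vec_angle (a - c) (b - c) \<le> \<gamma>"
  defines "s \<equiv> min (sin \<gamma>) (sin ((pi - \<gamma>) / 2))"
  shows "\<exists>p\<in>{a, b}. s * (dist a b * dist p c) \<le> norm ((b - a) \<times> (c - a))"
proof -
  have "s \<le> sin (vec_angle (b - a) (c - a)) \<or> s \<le> sin (vec_angle (a - b) (c - b))"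
    using two_angles_sin_bound[of "b - a" "c - a" \<gamma>] assms(1-6) unfolding s_def by auto
  then show ?thesis
  proof
    assume "s \<le> sin (vec_angle (b - a) (c - a))"
    then have "s * (dist a b * dist a c) \<le> sin (vec_angle (b - a) (c - a)) * (norm (b - a) * norm (c - a))"
      by (simp add: dist_norm norm_minus_commute mult_right_mono)
    then show ?thesis by (simp add: sin_vec_angle)
  next
    assume "s \<le> sin (vec_angle (a - b) (c - b))"
    then have "s * (dist a b * dist b c) \<le> sin (vec_angle (a - b) (c - b)) * (norm (a - b) * norm (c - b))"
      by (simp add: dist_norm norm_minus_commute mult_right_mono)
    also have "\<dots> = norm ((a - b) \<times> (c - b))" by (simp add: sin_vec_angle)
    also have "(a - b) \<times> (c - b) = - ((b - a) \<times> (c - a))"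
      by (simp add: cross3_simps)
    finally show ?thesis by auto
  qed
qed

text \<open>Three sines enter, one from the dihedral angle and one from each face at
  \<open>ab\<close>, whence \<open>s ^ 3\<close>. The constant is 6 from the volume formula times 3
  for the edges of the spanning tree.\<close>

lemma edge_lengths_le_volume:
  fixes a b c d :: "real^3"
  assumes indep: "\<not> affine_dependent {a, b, c, d}" and dist: "distinct [a, b, c, d]"
    and mac: "max_angle_condition \<gamma> (convex hull {a, b, c, d})"
    and \<gamma>: "pi / 3 \<le> \<gamma>" "\<gamma> < pi" and dih: "pi / 3 \<le> dihedral_angle a b c d"
  defines "T \<equiv> convex hull {a, b, c, d}" and "s \<equiv> min (sin \<gamma>) (sin ((pi - \<gamma>) / 2))"
  shows "edge_lengths T ! 0 * edge_lengths T ! 1 * diameter T * s ^ 3 \<le> 18 * measure lebesgue T"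
proof -
  let ?S = "{a, b, c, d}"
  let ?h = "edge_lengths T ! 0 * edge_lengths T ! 1"
  have S: "card ?S = 4" using dist by simp
  define w u v where "w = b - a" and "u = c - a" and "v = d - a"
  have w: "norm w = dist a b" "0 < dist a b" using dist by (auto simp: w_def dist_norm norm_minus_commute)
  note mac' = mac[unfolded max_angle_condition_convex_hull[OF indep S]]
  have angle: "vec_angle (y - x) (z - x) \<le> \<gamma>" if "{x, y, z} \<subseteq> ?S" "distinct [x, y, z]" for x y z
    by (rule mac'[THEN conjunct1, rule_format]) (use that in simp)
  have s: "0 \<le> s" using \<gamma> by (auto simp: s_def intro!: sin_ge_zero)
  have face: "\<exists>p\<in>{a, b}. s * (dist a b * dist p e) \<le> norm (w \<times> (e - a))" if "e \<in> {c, d}" for e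
    unfolding s_def w_def
  proof (rule norm_cross_triangle_ge)
    show "0 \<le> \<gamma>" "\<gamma> < pi" using \<gamma> pi_gt_zero by linarith+
    show *: "distinct [a, b, e]" using dist that by auto
    show "vec_angle (b - a) (e - a) \<le> \<gamma>" "vec_angle (a - b) (e - b) \<le> \<gamma>" "vec_angle (a - e) (b - e) \<le> \<gamma>"
      by (rule angle; use * that in auto)+
  qed
  obtain p where p: "p \<in> {a, b}" "s * (dist a b * dist p c) \<le> norm (w \<times> u)"
    using face[of c] unfolding u_def by blast
  obtain q where q: "q \<in> {a, b}" "s * (dist a b * dist q d) \<le> norm (w \<times> v)"
    using face[of d] unfolding v_def by blast
  define W P Q where "W = dist a b" and "P = dist p c" and "Q = dist q d"
  have nn: "0 < W" "0 \<le> P" "0 \<le> Q" using w by (simp_all add: W_def P_def Q_def)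
  have "dihedral_angle a b c d \<le> \<gamma>"
    by (rule mac'[THEN conjunct2, rule_format]) (use dist in simp)
  \<comment> \<open>From \<open>pi / 3 \<le> \<gamma>\<close> follows
    \<open>(pi - \<gamma>) / 2 \<le> pi / 3\<close>, so the dihedral angle lies in the range of
    \<open>sin_ge_min_sin\<close>.\<close>
  then have "s \<le> sin (dihedral_angle a b c d)"
    using \<gamma> dih unfolding s_def by (intro sin_ge_min_sin) auto
  then have "s * ((s * (W * P)) * (s * (W * Q))) \<le>
      sin (dihedral_angle a b c d) * (norm (w \<times> u) * norm (w \<times> v))"
    using p q s nn unfolding W_def P_def Q_def
    by (intro mult_mono) (auto intro!: mult_nonneg_nonneg)
  also have "\<dots> = W * \<bar>w \<bullet> (u \<times> v)\<bar>"
    using dist w sin_dihedral_angle[of w u v] by (simp add: dihedral_angle_cross w_def u_def v_def W_def)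
  also have "\<bar>w \<bullet> (u \<times> v)\<bar> = 6 * measure lebesgue T"
    using measure_tetrahedron[OF dist] by (simp add: T_def w_def u_def v_def)
  finally have "W * (s ^ 3 * (W * P * Q)) \<le> W * (6 * measure lebesgue T)"
    by (simp add: power3_eq_cube mult_ac)
  then have vol: "s ^ 3 * (W * P * Q) \<le> 6 * measure lebesgue T"
    using nn by simp
  note E = edge_lengths_nth_01(2)[OF indep S, folded T_def]
  \<comment> \<open>Since \<open>p\<close> and \<open>q\<close> lie in \<open>{a, b}\<close>, the
    edges \<open>ab\<close>, \<open>pc\<close>, \<open>qd\<close> are pairwise different.\<close>
  have hle: "?h \<le> W * P" "?h \<le> W * Q" "?h \<le> P * Q"
    unfolding W_def P_def Q_def using p(1) q(1) dist by (intro E; force simp: doubleton_eq_iff)+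
  have diam: "diameter T \<le> W + P + Q"
  proof -
    obtain x y where xy: "x \<in> ?S" "y \<in> ?S" "diameter T = dist x y"
      using diameter_convex_hull_attained[of ?S] unfolding T_def by blast
    have "dist a c \<le> W + P" "dist b c \<le> W + P" "dist a d \<le> W + Q" "dist b d \<le> W + Q"
      using p(1) q(1) nn dist_triangle[of a c b] dist_triangle[of b c a]
        dist_triangle[of a d b] dist_triangle[of b d a]
      by (auto simp: W_def P_def Q_def dist_commute)
    moreover have "dist c d \<le> W + P + Q"
      using p(1) q(1) nn calculation dist_triangle3[of c d p]
      by (auto simp: P_def Q_def)
    ultimately show ?thesis
      using xy nn by (auto simp: W_def dist_commute)
  qed
  have h0: "0 \<le> ?h"
    using edge_lengths_nth_01(1)[OF indep S, folded T_def] by auto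
  have "?h * diameter T \<le> ?h * (W + P + Q)"
    using diam h0 by (rule mult_left_mono)
  also have "\<dots> = ?h * W + ?h * P + ?h * Q" by (simp add: algebra_simps)
  \<comment> \<open>In each summand \<open>?h\<close> is bounded by the product of the two other
    tree edges, so that every summand becomes \<open>W * P * Q\<close>.\<close>
  also have "\<dots> \<le> (P * Q) * W + (W * Q) * P + (W * P) * Q"
    using hle nn by (intro add_mono mult_right_mono) auto
  finally have "?h * diameter T * s ^ 3 \<le> (3 * (W * P * Q)) * s ^ 3"
    using s by (intro mult_right_mono) (auto simp: algebra_simps)
  also have "\<dots> \<le> 18 * measure lebesgue T" using vol by (simp add: mult_ac)
  finally show ?thesis .
qed

section \<open>Upper volume bounds from an obtuse angle\<close>

text \<open>It is unknown which two edges are the shortest; the hypotheses list the fifteen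
  unordered pairs of the six edges.\<close>

lemma edge_pair_product_bound:
  fixes X h :: real and a b c d :: "'a::euclidean_space"
  assumes xy: "{x, y, x', y'} \<subseteq> {a, b, c, d}" "x \<noteq> y" "x' \<noteq> y'" "{x, y} \<noteq> {x', y'}"
    and "X \<le> dist a b * dist a c * h" "X \<le> dist a b * dist a d * h" "X \<le> dist a b * dist b c * h"
      "X \<le> dist a b * dist b d * h" "X \<le> dist a b * dist c d * h" "X \<le> dist a c * dist a d * h"
      "X \<le> dist a c * dist b c * h" "X \<le> dist a c * dist b d * h" "X \<le> dist a c * dist c d * h"
      "X \<le> dist a d * dist b c * h" "X \<le> dist a d * dist b d * h" "X \<le> dist a d * dist c d * h"
      "X \<le> dist b c * dist b d * h" "X \<le> dist b c * dist c d * h" "X \<le> dist b d * dist c d * h"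
  shows "X \<le> dist x y * dist x' y' * h"
proof -
  \<comment> \<open>Length as a function of the unordered vertex pair makes the orientation of an
    edge irrelevant in the case split.\<close>
  define f where "f e = diameter (convex hull e)" for e :: "'a set"
  have f: "f {p, q} = dist p q" for p q
    by (simp add: f_def diameter_closed_segment flip: segment_convex_hull)
  define E where "E = {{a, b}, {a, c}, {a, d}, {b, c}, {b, d}, {c, d}}"
  have *: "{x, y} \<in> E" if "x \<in> {a, b, c, d}" "y \<in> {a, b, c, d}" "x \<noteq> y" for x y
    using that unfolding E_def by (elim insertE emptyE) (simp_all add: insert_commute)
  have "X \<le> f e * f e' * h" if "e \<in> E" "e' \<in> E" "e \<noteq> e'" for e e'
    using that(1,2) unfolding E_def
    by (elim insertE emptyE) (use that(3) assms(5-) in \<open>simp_all add: f mult.commute\<close>)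
  from this[OF * * xy(4)] show ?thesis
    using xy by (simp add: f)
qed

lemma mult3_mono:
  fixes x y z x' y' z' :: real
  assumes "x \<le> x'" "y \<le> y'" "z \<le> z'" "0 \<le> x" "0 \<le> y" "0 \<le> z"
  shows "x * y * z \<le> x' * y' * z'"
  using assms by (intro mult_mono) (auto intro: mult_nonneg_nonneg)

lemma norm_cross_le: "norm (u \<times> v) \<le> norm u * norm v" for u v :: "real^3"
proof (rule power2_le_imp_le)
  show "(norm (u \<times> v))\<^sup>2 \<le> (norm u * norm v)\<^sup>2"
    using norm_cross_dot[of u v] zero_le_power2[of "u \<bullet> v"] by linarith
qed simp

text \<open>The height of \<open>d\<close> over the plane \<open>abc\<close> is at most the distance
  \<open>m\<close> to the nearest of \<open>a\<close>, \<open>b\<close>, \<open>c\<close>, so six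
  times the volume is at most \<open>p * q * m\<close> times the sine. It remains to bound
  \<open>p * q * m\<close> by any two edges times \<open>2 * h\<close>.\<close>

lemma face_angle_volume_le:
  fixes a b c d :: "real^3"
  assumes indep: "\<not> affine_dependent {a, b, c, d}" and dist: "distinct [a, b, c, d]"
    and obtuse: "pi / 2 < vec_angle (b - a) (c - a)"
  defines "T \<equiv> convex hull {a, b, c, d}"
  shows "6 * measure lebesgue T \<le>
    2 * (edge_lengths T ! 0 * edge_lengths T ! 1 * diameter T) * sin (vec_angle (b - a) (c - a))"
proof -
  let ?S = "{a, b, c, d}" and ?s = "sin (vec_angle (b - a) (c - a))"
  have S: "card ?S = 4" using dist by simp
  define p q r x y z h where pqr: "p = dist a b" "q = dist a c" "r = dist b c"
    "x = dist a d" "y = dist b d" "z = dist c d" "h = diameter T"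
  define m where "m = min x (min y z)"
  have nn: "0 \<le> p" "0 \<le> q" "0 \<le> r" "0 \<le> x" "0 \<le> y" "0 \<le> z" "0 \<le> m"
    by (simp_all add: pqr m_def)
  have leh: "p \<le> h" "q \<le> h" "r \<le> h" "x \<le> h" "y \<le> h" "z \<le> h" "m \<le> h"
    unfolding pqr T_def m_def min_le_iff_disj by (simp_all add: dist_le_diameter_convex_hull)
  have m: "m \<le> x" "m \<le> y" "m \<le> z" by (auto simp: m_def)
  have tri: "p \<le> x + y" "q \<le> x + z" "r \<le> y + z"
    unfolding pqr using dist_triangle2 by blast+
  have s: "0 \<le> ?s" by (simp add: vec_angle_bounds sin_ge_zero)
  \<comment> \<open>By the law of cosines, the side \<open>r\<close> opposite the obtuse angle is
    the longest of its triangle.\<close>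
  have "cos (vec_angle (b - a) (c - a)) \<le> 0"
    using obtuse vec_angle_bounds[of "b - a" "c - a"] cos_monotone_0_pi_le[of "pi/2"] by auto
  then have "(b - a) \<bullet> (c - a) \<le> 0"
    using cos_vec_angle[of "b - a" "c - a"] by (metis mult_nonneg_nonneg mult_nonpos_nonneg norm_ge_zero)
  moreover have "r\<^sup>2 = p\<^sup>2 + q\<^sup>2 - 2 * ((b - a) \<bullet> (c - a))"
    unfolding pqr dist_norm power2_norm_eq_inner by (simp add: inner_diff inner_commute)
  ultimately have "p\<^sup>2 \<le> r\<^sup>2" "q\<^sup>2 \<le> r\<^sup>2"
    using zero_le_power2[of p] zero_le_power2[of q] by linarith+
  then have r: "p \<le> r" "q \<le> r" using nn by (auto intro: power2_le_imp_le)
  have base: "norm ((b - a) \<times> (c - a)) = ?s * (p * q)"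
    by (simp add: sin_vec_angle[symmetric] pqr dist_norm norm_minus_commute)
  \<comment> \<open>The normal of the plane \<open>abc\<close> is orthogonal to its sides, so any of
    the three base vertices may replace \<open>a\<close>.\<close>
  have V: "6 * measure lebesgue T = \<bar>((b - a) \<times> (c - a)) \<bullet> (d - e)\<bar>" if "e \<in> {a, b, c}" for e
    using that measure_tetrahedron[OF dist] by (auto simp: T_def cross3_simps)
  have bound: "6 * measure lebesgue T \<le> norm ((b - a) \<times> (c - a)) * dist e d" if "e \<in> {a, b, c}" for e
    using V[OF that] Cauchy_Schwarz_ineq2[of "(b - a) \<times> (c - a)" "d - e"]
    by (simp add: dist_norm norm_minus_commute)
  have V6: "6 * measure lebesgue T \<le> ?s * (p * q * m)"
  proof -
    have "6 * measure lebesgue T \<le> ?s * (p * q) * x" "6 * measure lebesgue T \<le> ?s * (p * q) * y"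
      "6 * measure lebesgue T \<le> ?s * (p * q) * z"
      using bound[of a] bound[of b] bound[of c] unfolding base pqr(4-6) by simp_all
    moreover have "m = x \<or> m = y \<or> m = z" by (auto simp: m_def min_def)
    ultimately show ?thesis by (auto simp: mult.assoc)
  qed
  \<comment> \<open>The factor 2 arises here: a base side is at most the sum of the two edges
    joining its ends to \<open>d\<close>, and \<open>m\<close> is at most either of them.\<close>
  have dbl: "p * m \<le> 2 * (x * y)" "q * m \<le> 2 * (x * z)" "r * m \<le> 2 * (y * z)"
  proof -
    have *: "l * m \<le> 2 * (i * j)" if "l \<le> i + j" "m \<le> i" "m \<le> j" "0 \<le> i" "0 \<le> j" for l i j
    proof -
      have "l * m \<le> (i + j) * m" using that nn by (intro mult_right_mono) auto
      also have "\<dots> = i * m + m * j" by (simp add: algebra_simps)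
      also have "\<dots> \<le> i * j + i * j" using that nn by (intro add_mono mult_mono) auto
      finally show ?thesis by simp
    qed
    show "p * m \<le> 2 * (x * y)" "q * m \<le> 2 * (x * z)" "r * m \<le> 2 * (y * z)"
      using * tri m nn by blast+
  qed
  \<comment> \<open>For two edges \<open>i\<close>, \<open>j\<close> at \<open>d\<close>;
    \<open>l\<close> is the base side that completes their triangle.\<close>
  have dbl_h: "p * q * m \<le> i * j * (2 * h)" if "l * m \<le> 2 * (i * j)" "p * q \<le> l * h" for i j l
  proof -
    have "p * q * m \<le> l * h * m" using that nn by (intro mult_right_mono) auto
    also have "\<dots> \<le> (2 * (i * j)) * h" using that leh nn by (simp add: mult_ac mult_left_mono)
    finally show ?thesis by (simp add: mult_ac)
  qed
  \<comment> \<open>The remaining pairs of edges satisfy the bound already with \<open>h\<close> in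
    place of \<open>2 * h\<close>.\<close>
  have two: "p * q * m \<le> i * j * (2 * h)" if "p * q * m \<le> i * j * h" "0 \<le> i" "0 \<le> j" for i j
  proof -
    have "0 \<le> i * j * h" using that nn leh by (intro mult_nonneg_nonneg) auto
    moreover have "i * j * (2 * h) = 2 * (i * j * h)" by simp
    ultimately show ?thesis using that by linarith
  qed
  obtain e1 e2 e3 e4 where e: "e1 \<in> ?S" "e2 \<in> ?S" "e3 \<in> ?S" "e4 \<in> ?S" "e1 \<noteq> e2" "e3 \<noteq> e4" "{e1, e2} \<noteq> {e3, e4}"
    "edge_lengths T ! 0 = dist e1 e2" "edge_lengths T ! 1 = dist e3 e4"
    using edge_lengths_nth_01(1)[OF indep S, folded T_def] by blast
  have perm: "p * q * m = p * m * q" "p * q * m = q * m * p" "p * q * m = m * q * p"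
    "p * q * m = q * p * m" by simp_all
  have "p * q * m \<le> dist e1 e2 * dist e3 e4 * (2 * h)"
  proof (rule edge_pair_product_bound[of e1 e2 e3 e4 a b c d])
    show "p * q * m \<le> dist a b * dist a c * (2 * h)" "p * q * m \<le> dist a b * dist b c * (2 * h)"
      unfolding pqr(1-6)[symmetric] using nn leh r by (intro two mult3_mono; simp)+
    show "p * q * m \<le> dist a c * dist b c * (2 * h)"
      unfolding pqr(1-6)[symmetric] perm(4) using nn leh r by (intro two mult3_mono; simp)+
    show "p * q * m \<le> dist a b * dist a d * (2 * h)" "p * q * m \<le> dist a b * dist b d * (2 * h)"
       "p * q * m \<le> dist a b * dist c d * (2 * h)"
      unfolding pqr(1-6)[symmetric] perm(1) using nn leh m by (intro two mult3_mono; simp)+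
    show "p * q * m \<le> dist a c * dist a d * (2 * h)" "p * q * m \<le> dist a c * dist b d * (2 * h)"
       "p * q * m \<le> dist a c * dist c d * (2 * h)"
      unfolding pqr(1-6)[symmetric] perm(2) using nn leh m by (intro two mult3_mono; simp)+
    show "p * q * m \<le> dist a d * dist b c * (2 * h)"
      unfolding pqr(1-6)[symmetric] perm(3) using nn leh m r by (intro two mult3_mono; simp)
    show "p * q * m \<le> dist b c * dist b d * (2 * h)" "p * q * m \<le> dist b c * dist c d * (2 * h)"
      unfolding pqr(1-6)[symmetric] perm(2) using nn leh m r by (intro two mult3_mono; simp)+
    show "p * q * m \<le> dist a d * dist b d * (2 * h)"
      unfolding pqr(1-6)[symmetric] using dbl(1) by (rule dbl_h) (use nn leh in \<open>simp add: mult_left_mono\<close>)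
    show "p * q * m \<le> dist a d * dist c d * (2 * h)"
      unfolding pqr(1-6)[symmetric] using dbl(2) by (rule dbl_h) (use nn leh in \<open>simp add: mult.commute[of p] mult_left_mono\<close>)
    show "p * q * m \<le> dist b d * dist c d * (2 * h)"
      unfolding pqr(1-6)[symmetric] using dbl(3) by (rule dbl_h) (use nn leh r in \<open>simp add: mult_mono\<close>)
  qed (use e in auto)
  then have "?s * (p * q * m) \<le> ?s * (dist e1 e2 * dist e3 e4 * (2 * h))"
    using s by (rule mult_left_mono)
  with V6 show ?thesis unfolding e(8,9) pqr by (simp add: mult_ac)
qed

text \<open>Six times the volume equals \<open>W * C * E\<close> times the sine. For each pair of
  edges, a product of two of the three factors is bounded by the pair and the remaining factor by
  \<open>h\<close>.\<close>

lemma dihedral_angle_volume_le: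
  fixes a b c d :: "real^3"
  assumes indep: "\<not> affine_dependent {a, b, c, d}" and dist: "distinct [a, b, c, d]"
    and obtuse: "pi / 2 < dihedral_angle a b c d"
  defines "T \<equiv> convex hull {a, b, c, d}"
  shows "6 * measure lebesgue T \<le>
    (edge_lengths T ! 0 * edge_lengths T ! 1 * diameter T) * sin (dihedral_angle a b c d)"
proof -
  let ?S = "{a, b, c, d}"
  have S: "card ?S = 4" using dist by simp
  define w u v where wuv: "w = b - a" "u = c - a" "v = d - a"
  define s where "s = sin (dihedral_angle a b c d)"
  have dih: "dihedral_angle a b c d = vec_angle (w \<times> u) (w \<times> v)"
    using dist by (simp add: dihedral_angle_cross wuv)
  define h where "h = diameter T"
  define W where "W = norm w"
  define C where "C = norm (w \<times> u) / W"
  define E where "E = norm (w \<times> v) / W"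
  have W: "0 < W" "W = dist a b" using dist by (simp_all add: W_def wuv dist_norm norm_minus_commute)
  have WC: "W * C = norm (w \<times> u)" and WE: "W * E = norm (w \<times> v)"
    using W by (simp_all add: C_def E_def)
  have nn: "0 \<le> W" "0 \<le> C" "0 \<le> E" using W by (simp_all add: C_def E_def)
  have leh: "dist i j \<le> h" if "i \<in> ?S" "j \<in> ?S" for i j
    unfolding h_def T_def using that by (intro dist_le_diameter_convex_hull) auto
  have s: "0 \<le> s" by (simp add: s_def dih vec_angle_bounds sin_ge_zero)
  have "W * \<bar>w \<bullet> (u \<times> v)\<bar> = s * ((W * C) * (W * E))"
    unfolding s_def dih WC WE sin_dihedral_angle unfolding W_def ..
  then have "W * \<bar>w \<bullet> (u \<times> v)\<bar> = W * (s * (W * C * E))" by (simp add: mult_ac)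
  then have "\<bar>w \<bullet> (u \<times> v)\<bar> = s * (W * C * E)"
    using W(1) by simp
  then have V6: "6 * measure lebesgue T = s * (W * C * E)"
    using measure_tetrahedron[OF dist] unfolding T_def wuv by linarith
  have len: "dist a c = norm u" "dist a d = norm v" "dist b c = norm (c - b)" "dist b d = norm (d - b)"
    "dist c d = norm (c - d)"
    by (simp_all add: wuv dist_norm norm_minus_commute)
  have cross: "w \<times> u = w \<times> (c - b)" "w \<times> v = w \<times> (d - b)"
    "w \<times> u = u \<times> (c - b)" "w \<times> v = v \<times> (d - b)" "w \<times> (c - d) = w \<times> u - w \<times> v"
    by (simp_all add: wuv cross3_simps)
  have "W * C \<le> W * dist a c" "W * C \<le> W * dist b c" "W * E \<le> W * dist a d" "W * E \<le> W * dist b d"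
    unfolding WC WE len unfolding W_def
    using norm_cross_le[of w u] norm_cross_le[of w "c - b"] norm_cross_le[of w v] norm_cross_le[of w "d - b"]
    by (simp_all only: cross(1,2)[symmetric])
  then have side: "C \<le> dist a c" "C \<le> dist b c" "E \<le> dist a d" "E \<le> dist b d"
    using W(1) by simp_all
  \<comment> \<open>Twice the areas of the faces at \<open>ab\<close>. This settles the pairs
    \<open>ac\<close>, \<open>bc\<close> and \<open>ad\<close>, \<open>bd\<close>, where both edges
    belong to the same face.\<close>
  have area: "W * C \<le> dist a c * dist b c" "W * E \<le> dist a d * dist b d"
    unfolding WC WE len using norm_cross_le[of u "c - b"] norm_cross_le[of v "d - b"]
    by (simp_all only: cross(3,4)[symmetric])
  \<comment> \<open>Projected along \<open>ab\<close>, the edge \<open>cd\<close> becomes the side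
    opposite the obtuse angle in a triangle with sides \<open>C\<close> and \<open>E\<close>, so it
    is at least as long as either. All lengths are scaled by \<open>W\<close>.\<close>
  have opp: "C \<le> dist c d" "E \<le> dist c d"
  proof -
    have "cos (vec_angle (w \<times> u) (w \<times> v)) \<le> 0"
      using obtuse vec_angle_bounds[of "w \<times> u" "w \<times> v"] cos_monotone_0_pi_le[of "pi/2"]
      unfolding dih by auto
    then have "(w \<times> u) \<bullet> (w \<times> v) \<le> 0"
      using cos_vec_angle[of "w \<times> u" "w \<times> v"]
      by (metis mult_nonneg_nonneg mult_nonpos_nonneg norm_ge_zero)
    moreover have "(norm (w \<times> (c - d)))\<^sup>2 = (W * C)\<^sup>2 + (W * E)\<^sup>2 - 2 * ((w \<times> u) \<bullet> (w \<times> v))"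
      unfolding WC WE cross(5) by (simp add: power2_norm_eq_inner inner_diff inner_commute)
    ultimately have "(W * C)\<^sup>2 \<le> (norm (w \<times> (c - d)))\<^sup>2" "(W * E)\<^sup>2 \<le> (norm (w \<times> (c - d)))\<^sup>2"
      using zero_le_power2[of "W * C"] zero_le_power2[of "W * E"] by linarith+
    then have "W * C \<le> norm (w \<times> (c - d))" "W * E \<le> norm (w \<times> (c - d))"
      by (auto intro: power2_le_imp_le)
    moreover have "norm (w \<times> (c - d)) \<le> W * dist c d"
      unfolding len W_def by (rule norm_cross_le)
    ultimately have "W * C \<le> W * dist c d" "W * E \<le> W * dist c d"
      by linarith+
    then show "C \<le> dist c d" "E \<le> dist c d" using W(1) by simp_all
  qed
  obtain e1 e2 e3 e4 where e: "e1 \<in> ?S" "e2 \<in> ?S" "e3 \<in> ?S" "e4 \<in> ?S" "e1 \<noteq> e2" "e3 \<noteq> e4" "{e1, e2} \<noteq> {e3, e4}"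
    "edge_lengths T ! 0 = dist e1 e2" "edge_lengths T ! 1 = dist e3 e4"
    using edge_lengths_nth_01(1)[OF indep S, folded T_def] by blast
  have Eh: "E \<le> h" "C \<le> h" "W \<le> h"
    using opp leh[of c d] leh[of a b] W by auto
  have perm: "W * C * E = W * E * C" "W * C * E = C * E * W" "W * C * E = E * C * W"
    by simp_all
  have "W * C * E \<le> dist e1 e2 * dist e3 e4 * h"
  proof (rule edge_pair_product_bound[of e1 e2 e3 e4 a b c d])
    show "W * C * E \<le> dist a b * dist a c * h" "W * C * E \<le> dist a b * dist b c * h"
        "W * C * E \<le> dist a b * dist c d * h"
      using side opp Eh nn W by (intro mult3_mono; simp)+
    show "W * C * E \<le> dist a b * dist a d * h" "W * C * E \<le> dist a b * dist b d * h"
      unfolding perm(1) using side opp Eh nn W by (intro mult3_mono; simp)+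
    show "W * C * E \<le> dist a c * dist a d * h" "W * C * E \<le> dist a c * dist b d * h"
      "W * C * E \<le> dist a c * dist c d * h" "W * C * E \<le> dist b c * dist b d * h"
      "W * C * E \<le> dist b c * dist c d * h"
      unfolding perm(2) using side opp Eh nn W by (intro mult3_mono; simp)+
    show "W * C * E \<le> dist a d * dist b c * h" "W * C * E \<le> dist a d * dist c d * h"
        "W * C * E \<le> dist b d * dist c d * h"
      unfolding perm(3) using side opp Eh nn W by (intro mult3_mono; simp)+
    show "W * C * E \<le> dist a c * dist b c * h"
      by (rule mult_mono) (use area Eh nn in auto)
    show "W * C * E \<le> dist a d * dist b d * h"
      unfolding perm(1) by (rule mult_mono) (use area Eh nn in auto)
  qed (use e in auto)
  then have "s * (W * C * E) \<le> s * (dist e1 e2 * dist e3 e4 * h)"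
    using s by (rule mult_left_mono)
  then show ?thesis unfolding V6 e(8,9) h_def s_def by (simp add: mult_ac)
qed

section \<open>From the volume bounds to the two implications\<close>

text \<open>For obtuse \<open>x\<close>, \<open>pi - x\<close> is the arcsine of
  \<open>sin x\<close>, and arcsine is monotone; otherwise \<open>arcsin \<le> pi / 2\<close>
  suffices. The \<open>min 1\<close> keeps the argument in the domain of arcsine.\<close>

lemma angle_le_pi_minus_arcsin:
  assumes "0 < k" "0 \<le> x" "x \<le> pi" "pi / 2 < x \<Longrightarrow> k \<le> sin x"
  shows "x \<le> pi - arcsin (min 1 k)"
proof (cases "pi / 2 < x")
  case True
  then have "arcsin (min 1 k) \<le> arcsin (sin (pi - x))"
    using assms sin_le_one[of x] by (intro arcsin_le_arcsin) auto
  also have "\<dots> = pi - x"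
    using True assms by (intro arcsin_sin) auto
  finally show ?thesis by simp
next
  case False
  then show ?thesis using arcsin_ubound[of "min 1 k"] assms by auto
qed

lemma R_param_div_diameter:
  assumes "diameter T \<noteq> 0"
  shows "R_param T / diameter T = edge_lengths T ! 0 * edge_lengths T ! 1 * diameter T / measure lebesgue T"
  using assms by (simp add: R_param_def)

lemma tetrahedron_vertices:
  assumes "tetrahedron T"
  obtains S where "\<not> affine_dependent S" "card S = 4" "T = convex hull S" "0 < diameter T"
proof -
  obtain S where S: "\<not> affine_dependent S" "card S = 4" "T = convex hull S"
    using assms unfolding tetrahedron_def simplex_def by force
  have "diameter T > 0"
  proof -
    obtain U where "U \<subseteq> S" "card U = 2"
      using obtain_subset_with_card_n[of 2 S] S by auto
    then obtain x y where "x \<in> S" "y \<in> S" "x \<noteq> y"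
      by (auto simp: card_2_iff)
    then show ?thesis
      unfolding S(3) using dist_le_diameter_convex_hull[of S x y] aff_independent_finite[OF S(1)]
        zero_less_dist_iff[of x y] by linarith
  qed
  then show thesis using that S by blast
qed

lemma max_angle_imp_ratio_bound:
  assumes \<gamma>: "pi / 3 \<le> \<gamma>" "\<gamma> < pi" and "tetrahedron T" "max_angle_condition \<gamma> T"
  shows "R_param T / diameter T \<le> 18 / min (sin \<gamma>) (sin ((pi - \<gamma>) / 2)) ^ 3"
proof -
  obtain S where S: "\<not> affine_dependent S" "card S = 4" "T = convex hull S" "0 < diameter T"
    using assms tetrahedron_vertices by blast
  obtain a b c d where abcd: "S = {a, b, c, d}" "distinct [a, b, c, d]"
    using S(2) by (auto simp: card_Suc_eq numeral_eq_Suc)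
  let ?s = "min (sin \<gamma>) (sin ((pi - \<gamma>) / 2))"
  have s: "0 < ?s" using \<gamma> by (auto intro!: sin_gt_zero)
  have vol: "0 < measure lebesgue T" using measure_tetrahedron_pos S by blast
  have "(b - a) \<bullet> ((c - a) \<times> (d - a)) \<noteq> 0"
    using vol measure_tetrahedron[OF abcd(2)] S abcd by auto
  then have "pi / 3 \<le> dihedral_angle a b c d \<or> pi / 3 \<le> dihedral_angle a c d b \<or> pi / 3 \<le> dihedral_angle a d b c"
    using exists_dihedral_ge_pi_third[of "b - a" "c - a" "d - a"] abcd by (simp add: dihedral_angle_cross)
  moreover have "{a, c, d, b} = S" "{a, d, b, c} = S" using abcd by auto
  \<comment> \<open>A cyclic relabelling of the vertices other than \<open>a\<close> turns the edge
    with the large dihedral angle into \<open>ab'\<close>.\<close>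
  ultimately obtain b' c' d' where "S = {a, b', c', d'}" "distinct [a, b', c', d']"
     "pi / 3 \<le> dihedral_angle a b' c' d'"
    using abcd by (elim disjE) (auto simp del: insert_iff)
  then have "edge_lengths T ! 0 * edge_lengths T ! 1 * diameter T * ?s ^ 3 \<le> 18 * measure lebesgue T"
    using edge_lengths_le_volume[of a b' c' d' \<gamma>] S assms by simp
  then show ?thesis
    using S s vol by (simp add: R_param_div_diameter field_simps)
qed

lemma ratio_bound_imp_max_angle:
  assumes D: "0 < D" "tetrahedron T" "R_param T / diameter T \<le> D"
  shows "max_angle_condition (pi - arcsin (min 1 (3 / D))) T"
proof -
  obtain S where S: "\<not> affine_dependent S" "card S = 4" "T = convex hull S" "0 < diameter T"
    using assms tetrahedron_vertices by blast
  let ?h = "edge_lengths T ! 0 * edge_lengths T ! 1 * diameter T"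
  have vol: "0 < measure lebesgue T" using measure_tetrahedron_pos S by blast
  have h: "?h \<le> D * measure lebesgue T"
    using D S vol by (simp add: R_param_div_diameter field_simps)
  \<comment> \<open>Inserting \<open>?h \<le> D * measure lebesgue T\<close> into the volume bound
    and cancelling the positive volume leaves \<open>6 \<le> 2 * D * s\<close>.\<close>
  have key: "3 / D \<le> s" if "6 * measure lebesgue T \<le> 2 * ?h * s" "0 \<le> s" for s
  proof -
    have "?h * s \<le> D * measure lebesgue T * s" using h that by (intro mult_right_mono)
    then have "3 * measure lebesgue T \<le> D * s * measure lebesgue T"
      using that by (simp add: mult_ac)
    then have "3 \<le> D * s" using vol by simp
    then show ?thesis using D by (simp add: field_simps)
  qed
  have h0: "0 \<le> ?h"
    using edge_lengths_nth_01(1)[OF S(1,2)] S by auto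
  show ?thesis
    unfolding S(3) max_angle_condition_convex_hull[OF S(1,2)]
  proof (intro conjI allI impI)
    fix a b c assume *: "{a, b, c} \<subseteq> S \<and> distinct [a, b, c]"
    \<comment> \<open>The face angle concerns three vertices; the volume bound also involves the
      fourth.\<close>
    have "card (S - {a, b, c}) = 1"
      using * S card_Diff_subset[of "{a, b, c}" S] by simp
    then obtain d where "S - {a, b, c} = {d}" by (rule card_1_singletonE)
    then have d: "S = {a, b, c, d}" "distinct [a, b, c, d]" using * by auto
    show "vec_angle (b - a) (c - a) \<le> pi - arcsin (min 1 (3 / D))"
    proof (rule angle_le_pi_minus_arcsin)
      assume "pi / 2 < vec_angle (b - a) (c - a)"
      then have "6 * measure lebesgue T \<le> 2 * ?h * sin (vec_angle (b - a) (c - a))"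
        using face_angle_volume_le[of a b c d] S d by simp
      then show "3 / D \<le> sin (vec_angle (b - a) (c - a))"
        by (rule key) (simp add: vec_angle_bounds sin_ge_zero)
    qed (use D vec_angle_bounds in auto)
  next
    fix a b c d assume *: "{a, b, c, d} \<subseteq> S \<and> distinct [a, b, c, d]"
    then have d: "S = {a, b, c, d}" "distinct [a, b, c, d]"
      using S aff_independent_finite[OF S(1)] card_subset_eq[of S "{a, b, c, d}"] by auto
    have b: "0 \<le> dihedral_angle a b c d" "dihedral_angle a b c d \<le> pi"
      unfolding dihedral_angle_def by (rule vec_angle_bounds)+
    then have sn: "0 \<le> sin (dihedral_angle a b c d)" by (rule sin_ge_zero)
    show "dihedral_angle a b c d \<le> pi - arcsin (min 1 (3 / D))"
    proof (rule angle_le_pi_minus_arcsin)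
      assume "pi / 2 < dihedral_angle a b c d"
      then have "6 * measure lebesgue T \<le> ?h * sin (dihedral_angle a b c d)"
        using dihedral_angle_volume_le[of a b c d] S d by simp
      \<comment> \<open>Weakened by the factor 2 so that one threshold \<open>3 / D\<close> serves
        both kinds of angles.\<close>
      also have "\<dots> \<le> 2 * ?h * sin (dihedral_angle a b c d)"
        using mult_nonneg_nonneg[OF h0 sn] by linarith
      finally show "3 / D \<le> sin (dihedral_angle a b c d)" using sn by (rule key)
    qed (use D b in auto)
  qed
qed

theorem theorem3:
  shows "(\<forall>\<gamma>::real. pi / 3 \<le> \<gamma> \<and> \<gamma> < pi \<longrightarrow>
            (\<exists>D>0. \<forall>T. tetrahedron T \<and> max_angle_condition \<gamma> T
                     \<longrightarrow> R_param T / diameter T \<le> D)) \<and>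
         (\<forall>D::real. D > 0 \<longrightarrow>
            (\<exists>\<gamma>. pi / 3 \<le> \<gamma> \<and> \<gamma> < pi \<and>
               (\<forall>T. tetrahedron T \<and> R_param T / diameter T \<le> D
                     \<longrightarrow> max_angle_condition \<gamma> T)))"
proof (intro conjI allI impI)
  fix \<gamma> :: real assume \<gamma>: "pi / 3 \<le> \<gamma> \<and> \<gamma> < pi"
  then have "0 < 18 / min (sin \<gamma>) (sin ((pi - \<gamma>) / 2)) ^ 3"
    by (auto intro!: divide_pos_pos zero_less_power sin_gt_zero)
  then show "\<exists>D>0. \<forall>T. tetrahedron T \<and> max_angle_condition \<gamma> T \<longrightarrow> R_param T / diameter T \<le> D"
    using \<gamma> max_angle_imp_ratio_bound by blast
next
  fix D :: real assume D: "D > 0"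
  let ?\<gamma> = "pi - arcsin (min 1 (3 / D))"
  \<comment> \<open>This makes \<open>?\<gamma>\<close> at least \<open>pi / 2\<close>, hence at
    least \<open>pi / 3\<close>; positivity of the arcsine makes it less than
    \<open>pi\<close>.\<close>
  have "arcsin (min 1 (3 / D)) \<le> pi / 2"
    using D by (intro arcsin_ubound) (auto simp: order_trans[of "-1" 0])
  moreover have "arcsin 0 < arcsin (min 1 (3 / D))"
    using D by (intro arcsin_less_arcsin) auto
  ultimately have "pi / 3 \<le> ?\<gamma>" "?\<gamma> < pi"
    using pi_gt_zero by auto
  then show "\<exists>\<gamma>. pi / 3 \<le> \<gamma> \<and> \<gamma> < pi \<and>
      (\<forall>T. tetrahedron T \<and> R_param T / diameter T \<le> D \<longrightarrow> max_angle_condition \<gamma> T)"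
    using D ratio_bound_imp_max_angle by blast
qed

end
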